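(* Let $M$ be an MDP. There exists a strategy $\alpha$ such that $M$ with $\alpha$ is strongly synchronizing if and only if the perfect-information subset construction $M^{\mathsf P}$ of $M$ has an accessible cycle $C$ such that $|\Delta(C)|=1$ and, for the unique $G=g_0g_1\dots g_d\in\Delta(C)$, every $g_i$ satisfies $|g_i|=1$.
   Context: A probability distribution on a finite set $S$ is $d:S\to[0,1]$ with $\sum_s d(s)=1$; ${\sf Supp}(d)=\{s:d(s)>0\}$; $\mathcal D(S)$ is the set of distributions on $S$. An MDP is $M=\langle L,\mu_0,\Sigma,\delta\rangle$ with finite state set $L$, initial distribution $\mu_0\in\mathcal D(L)$, finite action set $\Sigma$, and $\delta:L\times\Sigma\to\mathcal D(L)$. $Post_\sigma(\ell)={\sf Supp}(\delta(\ell,\sigma))$. A history is a finite sequence $h=\ell_0\sigma_0\ell_1\cdots\sigma_{n-1}\ell_n$ with $\ell_{i+1}\in Post_{\sigma_i}(\ell_i)$; $|h|=n$. A strategy is any map $\alpha$ from histories to $\mathcal D(\Sigma)$ (randomized, with memory, observing states). The probability of $h$ under $\alpha$ is $Pr^\alpha(h)=\mu_0(\ell_0)\prod_{j=1}^n\alpha(\ell_0\sigma_0\cdots\ell_{j-1})(\sigma_{j-1})\,\delta(\ell_{j-1},\sigma_{j-1})(\ell_j)$; the outcome is $X^\alpha_0=\mu_0$, $X^\alpha_n(\ell)=\sum_{|h|=n,\,{\sf Last}(h)=\ell}Pr^\alpha(h)$. With $\|X\|=\max_{\ell}X(\ell)$, $M$ with $\alpha$ is strongly synchronizing if $\liminf_{n\to\infty}\|X^\alpha_n\|=1$.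 Perfect-information subset construction: $M^{\mathsf P}$ has cells (states) the nonempty subsets of $L$, initial cell $L_I={\sf Supp}(\mu_0)$, alphabet $\hat\Sigma$ = all functions $\hat\sigma:L\to\Sigma$, and deterministic transitions $\delta^{\mathsf P}(s,\hat\sigma)=\bigcup_{\ell\in s}Post_{\hat\sigma(\ell)}(\ell)$. A cycle of $M^{\mathsf P}$ is a sequence $C=s_0\hat\sigma_0s_1\cdots s_{d-1}\hat\sigma_{d-1}s_d$ with $d\ge1$, $\delta^{\mathsf P}(s_j,\hat\sigma_j)=s_{j+1}$ for $0\le j<d$, and $s_d=s_0$; it is accessible if $s_0$ is reachable from $L_I$ by a finite path in $M^{\mathsf P}$. A recurrent cyclic set for $C$ is a sequence $G=g_0g_1\cdots g_d$ with $g_0=g_d$, $\emptyset\ne g_i\subseteq s_i$ and $\bigcup_{\ell\in g_i}Post_{\hat\sigma_i(\ell)}(\ell)=g_{i+1}$ for $0\le i<d$. It is minimal if there is no other recurrent cyclic set $G'\neq G$ for $C$ with $g'_i\subseteq g_i$ for all $0\le i<d$. $\Delta(C)$ is the set of minimal recurrent cyclic sets of $C$. *)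

theory Defs
  imports "HOL-Probability.Probability"
begin

text \<open>
  The finite state set and the finite action set are types of class \<open>finite\<close>. A probability
  distribution on a finite set is a \<open>pmf\<close> on the corresponding type, and its support is \<open>set_pmf\<close>.
\<close>

record ('l, 'a) mdp =
  init :: "'l pmf"
  trans :: "'l \<Rightarrow> 'a \<Rightarrow> 'l pmf"

definition Post :: "('l, 'a) mdp \<Rightarrow> 'a \<Rightarrow> 'l \<Rightarrow> 'l set" where
  "Post M \<sigma> l = set_pmf (trans M l \<sigma>)"

text \<open>
  The sequence \<open>l\<^sub>0 \<sigma>\<^sub>0 l\<^sub>1 \<dots> \<sigma>\<^sub>n\<^sub>-\<^sub>1 l\<^sub>n\<close> is represented by the pair of \<open>l\<^sub>0\<close> and the list
  \<open>[(\<sigma>\<^sub>0, l\<^sub>1), \<dots>, (\<sigma>\<^sub>n\<^sub>-\<^sub>1, l\<^sub>n)]\<close>. Such a sequence need not be a history of a given MDP.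
\<close>

type_synonym ('l, 'a) run = "'l \<times> ('a \<times> 'l) list"

definition run_length :: "('l, 'a) run \<Rightarrow> nat" where
  "run_length h = length (snd h)"

definition state_at :: "('l, 'a) run \<Rightarrow> nat \<Rightarrow> 'l" where
  "state_at h j = (case j of 0 \<Rightarrow> fst h | Suc i \<Rightarrow> snd (snd h ! i))"

definition action_at :: "('l, 'a) run \<Rightarrow> nat \<Rightarrow> 'a" where
  "action_at h j = fst (snd h ! j)"

definition prefix_upto :: "('l, 'a) run \<Rightarrow> nat \<Rightarrow> ('l, 'a) run" where
  "prefix_upto h j = (fst h, take j (snd h))"

definition last_state :: "('l, 'a) run \<Rightarrow> 'l" where
  "last_state h = state_at h (run_length h)"

definition history :: "('l, 'a) mdp \<Rightarrow> ('l, 'a) run \<Rightarrow> bool" where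
  "history M h \<longleftrightarrow>
     (\<forall>i < run_length h. state_at h (Suc i) \<in> Post M (action_at h i) (state_at h i))"

text \<open>
  A strategy is total on runs; its values on runs that are not histories of the MDP are never
  used in the definition of \<open>outcome\<close>.
\<close>

type_synonym ('l, 'a) strategy = "('l, 'a) run \<Rightarrow> 'a pmf"

definition history_prob :: "('l, 'a) mdp \<Rightarrow> ('l, 'a) strategy \<Rightarrow> ('l, 'a) run \<Rightarrow> real" where
  "history_prob M \<alpha> h =
     pmf (init M) (state_at h 0) *
     (\<Prod>j = 1..run_length h.
        pmf (\<alpha> (prefix_upto h (j - 1))) (action_at h (j - 1)) *
        pmf (trans M (state_at h (j - 1)) (action_at h (j - 1))) (state_at h j))"

definition outcome ::
  "('l::finite, 'a::finite) mdp \<Rightarrow> ('l, 'a) strategy \<Rightarrow> nat \<Rightarrow> 'l \<Rightarrow> real" where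
  "outcome M \<alpha> n l =
     (\<Sum>h | history M h \<and> run_length h = n \<and> last_state h = l. history_prob M \<alpha> h)"

lemma finite_histories:
  fixes M :: "('l::finite, 'a::finite) mdp"
  shows "finite {h. history M h \<and> run_length h = n \<and> last_state h = l}"
proof (rule finite_subset)
  show "{h. history M h \<and> run_length h = n \<and> last_state h = l}
          \<subseteq> UNIV \<times> {xs. set xs \<subseteq> UNIV \<and> length xs = n}"
    by (auto simp: run_length_def)
  show "finite ((UNIV :: 'l set) \<times> {xs :: ('a \<times> 'l) list. set xs \<subseteq> UNIV \<and> length xs = n})"
    by (intro finite_cartesian_product finite_lists_length_eq) auto
qed

lemma outcome_0: "outcome M \<alpha> 0 l = pmf (init M) l"
proof -
  have "{h. history M h \<and> run_length h = 0 \<and> last_state h = l} = {(l, [])}"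
    by (auto simp: history_def run_length_def last_state_def state_at_def)
  then show ?thesis
    by (simp add: outcome_def history_prob_def run_length_def state_at_def)
qed

definition max_norm :: "('l::finite \<Rightarrow> real) \<Rightarrow> real" where
  "max_norm X = Max (range X)"

definition strongly_synchronizing ::
  "('l::finite, 'a::finite) mdp \<Rightarrow> ('l, 'a) strategy \<Rightarrow> bool" where
  "strongly_synchronizing M \<alpha> \<longleftrightarrow> liminf (\<lambda>n. ereal (max_norm (outcome M \<alpha> n))) = 1"

definition cells :: "'l set set" where
  "cells = {s. s \<noteq> {}}"

definition init_cell :: "('l, 'a) mdp \<Rightarrow> 'l set" where
  "init_cell M = set_pmf (init M)"

definition cell_trans :: "('l, 'a) mdp \<Rightarrow> 'l set \<Rightarrow> ('l \<Rightarrow> 'a) \<Rightarrow> 'l set" where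
  "cell_trans M s f = (\<Union>l\<in>s. Post M (f l) l)"

lemma init_cell_in_cells: "init_cell M \<in> cells"
  by (simp add: init_cell_def cells_def set_pmf_not_empty)

lemma cell_trans_in_cells: "s \<in> cells \<Longrightarrow> cell_trans M s f \<in> cells"
  by (auto simp: cell_trans_def cells_def Post_def set_pmf_not_empty)

definition reachable_cell :: "('l, 'a) mdp \<Rightarrow> 'l set \<Rightarrow> bool" where
  "reachable_cell M s \<longleftrightarrow> (\<lambda>t t'. \<exists>f. t' = cell_trans M t f)\<^sup>*\<^sup>* (init_cell M) s"

text \<open>
  The sequence \<open>s\<^sub>0 f\<^sub>0 s\<^sub>1 \<dots> f\<^sub>d\<^sub>-\<^sub>1 s\<^sub>d\<close> is represented by the list of its \<open>d + 1\<close> cells and the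
  list of its \<open>d\<close> letters.
\<close>

type_synonym ('l, 'a) cell_path = "'l set list \<times> ('l \<Rightarrow> 'a) list"

definition is_cycle :: "('l, 'a) mdp \<Rightarrow> ('l, 'a) cell_path \<Rightarrow> bool" where
  "is_cycle M C \<longleftrightarrow> (case C of (ss, fs) \<Rightarrow>
     length fs \<ge> 1 \<and> length ss = length fs + 1 \<and> set ss \<subseteq> cells \<and>
     (\<forall>j < length fs. cell_trans M (ss ! j) (fs ! j) = ss ! (j + 1)) \<and>
     ss ! length fs = ss ! 0)"

definition accessible_cycle :: "('l, 'a) mdp \<Rightarrow> ('l, 'a) cell_path \<Rightarrow> bool" where
  "accessible_cycle M C \<longleftrightarrow> is_cycle M C \<and> reachable_cell M (fst C ! 0)"

definition recurrent_cyclic_set ::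
  "('l, 'a) mdp \<Rightarrow> ('l, 'a) cell_path \<Rightarrow> 'l set list \<Rightarrow> bool" where
  "recurrent_cyclic_set M C G \<longleftrightarrow> (case C of (ss, fs) \<Rightarrow>
     length G = length fs + 1 \<and> G ! 0 = G ! length fs \<and>
     (\<forall>i < length fs. G ! i \<noteq> {} \<and> G ! i \<subseteq> ss ! i \<and>
        (\<Union>l\<in>G ! i. Post M ((fs ! i) l) l) = G ! (i + 1)))"

definition minimal_recurrent_cyclic_set ::
  "('l, 'a) mdp \<Rightarrow> ('l, 'a) cell_path \<Rightarrow> 'l set list \<Rightarrow> bool" where
  "minimal_recurrent_cyclic_set M C G \<longleftrightarrow>
     recurrent_cyclic_set M C G \<and>
     \<not> (\<exists>G'. recurrent_cyclic_set M C G' \<and> G' \<noteq> G \<and> (\<forall>i < length (snd C). G' ! i \<subseteq> G ! i))"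

definition \<Delta> :: "('l, 'a) mdp \<Rightarrow> ('l, 'a) cell_path \<Rightarrow> 'l set list set" where
  "\<Delta> M C = {G. minimal_recurrent_cyclic_set M C G}"

end

theory Submission
  imports Defs
begin

text \<open>
  If a strategy synchronizes in states \<open>t n\<close>, then for large \<open>n\<close> some action in its support leads
  surely from \<open>t n\<close> to \<open>t (n + 1)\<close>, and no state carrying mass can be unable to reach \<open>t\<close>. Choosing
  in each state and time an action of the support that decreases the distance to \<open>t\<close> gives a run of
  the subset construction; two far apart occurrences of the same pair of a cell and a state \<open>t n\<close>
  bound a cycle whose only minimal recurrent cyclic set is the orbit of that state.
  Conversely, repeating a cycle yields a periodic Markov chain in which the singleton orbit is
  absorbing; a state that could not reach it would belong to a closed set disjoint from it, and that
  set would contain a second minimal recurrent cyclic set.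
\<close>

section \<open>The mass flow of a strategy\<close>

text \<open>The joint mass of current state and next action. It condenses a history-dependent
  strategy into finitely many numbers per time step, which suffice for all later estimates. Summing
  over all runs is harmless, since runs that are not histories have probability 0.\<close>

definition flow :: "('l::finite, 'a::finite) mdp \<Rightarrow> ('l, 'a) strategy \<Rightarrow> nat \<Rightarrow> 'l \<Rightarrow> 'a \<Rightarrow> real" where
  "flow M \<alpha> n l \<sigma> =
     (\<Sum>h | run_length h = n \<and> last_state h = l. history_prob M \<alpha> h * pmf (\<alpha> h) \<sigma>)"

lemma finite_runs: "finite {h :: ('l::finite, 'a::finite) run. run_length h = n}"
proof (rule finite_subset)
  show "{h :: ('l, 'a) run. run_length h = n} \<subseteq> UNIV \<times> {xs. set xs \<subseteq> UNIV \<and> length xs = n}"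
    by (auto simp: run_length_def)
  show "finite ((UNIV :: 'l set) \<times> {xs :: ('a \<times> 'l) list. set xs \<subseteq> UNIV \<and> length xs = n})"
    by (intro finite_cartesian_product finite_lists_length_eq) auto
qed

lemma history_prob_nonneg: "history_prob M \<alpha> h \<ge> 0"
  by (auto simp: history_prob_def intro!: prod_nonneg mult_nonneg_nonneg)

lemma history_prob_eq_0:
  assumes "\<not> history M h"
  shows "history_prob M \<alpha> h = 0"
proof -
  obtain i where i: "i < run_length h"
      "state_at h (Suc i) \<notin> Post M (action_at h i) (state_at h i)"
    using assms by (auto simp: history_def)
  then have "pmf (trans M (state_at h i) (action_at h i)) (state_at h (Suc i)) = 0"
    by (simp add: Post_def set_pmf_iff)
  then have "(\<Prod>j = 1..run_length h.
        pmf (\<alpha> (prefix_upto h (j - 1))) (action_at h (j - 1)) *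
        pmf (trans M (state_at h (j - 1)) (action_at h (j - 1))) (state_at h j)) = 0"
    using i(1) by (intro prod_zero bexI[of _ "Suc i"]) auto
  then show ?thesis by (simp add: history_prob_def)
qed

lemma outcome_eq_sum_runs:
  "outcome M \<alpha> n l = (\<Sum>h | run_length h = n \<and> last_state h = l. history_prob M \<alpha> h)"
  unfolding outcome_def
  by (rule sum.mono_neutral_left)
     (auto intro: finite_subset[OF _ finite_runs[of n]] history_prob_eq_0)

lemma history_prob_snoc:
  "history_prob M \<alpha> (l0, xs @ [(\<sigma>, l)]) =
     history_prob M \<alpha> (l0, xs) * (pmf (\<alpha> (l0, xs)) \<sigma> * pmf (trans M (last_state (l0, xs)) \<sigma>) l)"
proof -
  let ?h = "(l0, xs)" and ?h' = "(l0, xs @ [(\<sigma>, l)])"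
  have st: "state_at ?h' j = state_at ?h j" if "j \<le> length xs" for j
    using that by (cases j) (auto simp: state_at_def nth_append)
  have ac: "action_at ?h' j = action_at ?h j" if "j < length xs" for j
    using that by (auto simp: action_at_def nth_append)
  have "(\<Prod>j = 1..length xs.
        pmf (\<alpha> (prefix_upto ?h' (j - 1))) (action_at ?h' (j - 1)) *
        pmf (trans M (state_at ?h' (j - 1)) (action_at ?h' (j - 1))) (state_at ?h' j)) =
      (\<Prod>j = 1..length xs.
        pmf (\<alpha> (prefix_upto ?h (j - 1))) (action_at ?h (j - 1)) *
        pmf (trans M (state_at ?h (j - 1)) (action_at ?h (j - 1))) (state_at ?h j))"
    by (rule prod.cong) (auto simp: st ac prefix_upto_def)
  moreover have "state_at ?h' (Suc (length xs)) = l" "action_at ?h' (length xs) = \<sigma>"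
    by (auto simp: state_at_def action_at_def)
  ultimately show ?thesis
    by (simp add: history_prob_def run_length_def st last_state_def prefix_upto_def)
qed

lemma outcome_nonneg: "outcome M \<alpha> n l \<ge> 0"
  by (simp add: outcome_def sum_nonneg history_prob_nonneg)

lemma flow_nonneg: "flow M \<alpha> n l \<sigma> \<ge> 0"
  by (simp add: flow_def sum_nonneg history_prob_nonneg)

lemma sum_flow: "(\<Sum>\<sigma>\<in>UNIV. flow M \<alpha> n l \<sigma>) = outcome M \<alpha> n l"
proof -
  have "(\<Sum>\<sigma>\<in>UNIV. flow M \<alpha> n l \<sigma>) = (\<Sum>h | run_length h = n \<and> last_state h = l.
      history_prob M \<alpha> h * (\<Sum>\<sigma>\<in>UNIV. pmf (\<alpha> h) \<sigma>))"
    unfolding flow_def by (subst sum.swap) (simp add: sum_distrib_left)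
  also have "\<dots> = outcome M \<alpha> n l"
    by (simp add: sum_pmf_eq_1 outcome_eq_sum_runs)
  finally show ?thesis .
qed

text \<open>A run of length \<open>n + 1\<close> ending in \<open>l'\<close> is a run of length
  \<open>n\<close> with one more action; \<open>history_prob_snoc\<close> splits its weight, and
  grouping by the state before that action leaves only the flow. So the outcomes obey a one-step
  balance even if the strategy uses memory.\<close>

lemma outcome_Suc:
  "outcome M \<alpha> (Suc n) l' = (\<Sum>l\<in>UNIV. \<Sum>\<sigma>\<in>UNIV. flow M \<alpha> n l \<sigma> * pmf (trans M l \<sigma>) l')"
proof -
  let ?R = "{h. run_length h = n}"
  let ?w = "\<lambda>\<sigma> h. history_prob M \<alpha> h * pmf (\<alpha> h) \<sigma> * pmf (trans M (last_state h) \<sigma>) l'"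
  have bij: "bij_betw (\<lambda>(\<sigma>, h). (fst h, snd h @ [(\<sigma>, l')])) (UNIV \<times> ?R)
          {h. run_length h = Suc n \<and> last_state h = l'}"
  proof (rule bij_betwI', goal_cases)
    case (1 x y)
    then show ?case by (cases x; cases y) (auto intro: prod_eqI)
  next
    case (2 x)
    then show ?case by (cases x) (auto simp: run_length_def last_state_def state_at_def)
  next
    case (3 h)
    have len: "length (snd h) = Suc n" and la: "snd (snd h ! n) = l'"
      using 3 by (auto simp: run_length_def last_state_def state_at_def)
    obtain ys y where s: "snd h = ys @ [y]" "length ys = n"
      using len by (metis length_Suc_conv_rev)
    with la have "y = (fst y, l')" by (cases y) (auto simp: nth_append)
    with s show ?case
      by (intro bexI[of _ "(fst y, (fst h, ys))"]) (auto simp: run_length_def prod_eq_iff)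
  qed
  have "outcome M \<alpha> (Suc n) l' =
      (\<Sum>(\<sigma>, h)\<in>UNIV \<times> ?R. history_prob M \<alpha> (fst h, snd h @ [(\<sigma>, l')]))"
    unfolding outcome_eq_sum_runs
    by (subst sum.reindex_bij_betw[OF bij, symmetric]) (simp add: case_prod_unfold)
  also have "\<dots> = (\<Sum>\<sigma>\<in>UNIV. \<Sum>h\<in>?R. ?w \<sigma> h)"
    by (simp add: sum.cartesian_product[symmetric] history_prob_snoc mult.assoc)
  also have "\<dots> = (\<Sum>\<sigma>\<in>UNIV. \<Sum>l\<in>UNIV. \<Sum>h | h \<in> ?R \<and> last_state h = l. ?w \<sigma> h)"
    by (intro sum.cong refl sum.group[symmetric] finite_runs) auto
  also have "\<dots> = (\<Sum>\<sigma>\<in>UNIV. \<Sum>l\<in>UNIV. flow M \<alpha> n l \<sigma> * pmf (trans M l \<sigma>) l')"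
    by (simp add: flow_def sum_distrib_right)
  finally show ?thesis by (subst sum.swap)
qed

lemma sum_outcome: "(\<Sum>l\<in>UNIV. outcome M \<alpha> n l) = 1"
proof (induction n)
  case 0
  then show ?case by (simp add: outcome_0 sum_pmf_eq_1)
next
  case (Suc n)
  have "(\<Sum>l'\<in>UNIV. outcome M \<alpha> (Suc n) l') =
      (\<Sum>l\<in>UNIV. \<Sum>\<sigma>\<in>UNIV. \<Sum>l'\<in>UNIV. flow M \<alpha> n l \<sigma> * pmf (trans M l \<sigma>) l')"
    unfolding outcome_Suc by (subst sum.swap) (intro sum.cong refl sum.swap)
  also have "\<dots> = 1"
    by (simp add: sum_distrib_left[symmetric] sum_pmf_eq_1 sum_flow Suc.IH)
  finally show ?case .
qed

lemma flow_le_outcome: "flow M \<alpha> n l \<sigma> \<le> outcome M \<alpha> n l"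
  unfolding sum_flow[symmetric] by (rule member_le_sum) (auto simp: flow_nonneg)

lemma outcome_Suc_ge: "flow M \<alpha> n l \<sigma> * pmf (trans M l \<sigma>) l' \<le> outcome M \<alpha> (Suc n) l'"
proof -
  have "flow M \<alpha> n l \<sigma> * pmf (trans M l \<sigma>) l' \<le> (\<Sum>\<sigma>\<in>UNIV. flow M \<alpha> n l \<sigma> * pmf (trans M l \<sigma>) l')"
    by (rule member_le_sum) (auto simp: flow_nonneg)
  also have "\<dots> \<le> outcome M \<alpha> (Suc n) l'"
    unfolding outcome_Suc
    by (rule member_le_sum[where f = "\<lambda>l. \<Sum>\<sigma>\<in>UNIV. flow M \<alpha> n l \<sigma> * pmf (trans M l \<sigma>) l'"])
       (auto intro!: sum_nonneg simp: flow_nonneg)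
  finally show ?thesis .
qed

lemma outcome_le_1: "outcome M \<alpha> n l \<le> 1"
  unfolding sum_outcome[of M \<alpha> n, symmetric] by (rule member_le_sum) (auto simp: outcome_nonneg)

section \<open>Strong synchronization as convergence of the maximum norm\<close>

lemma max_norm_ge: "X l \<le> max_norm X"
  by (simp add: max_norm_def)

lemma max_norm_attained: "\<exists>l. max_norm X = X l"
proof -
  have "Max (range X) \<in> range X" by (rule Max_in) auto
  then show ?thesis unfolding max_norm_def by blast
qed

lemma max_norm_outcome_le_1: "max_norm (outcome M \<alpha> n) \<le> 1"
  using max_norm_attained[of "outcome M \<alpha> n"] outcome_le_1 by metis

text \<open>The norm never exceeds 1, so a lower limit of 1 already forces convergence.\<close>

lemma strongly_synchronizing_iff_tendsto:
  "strongly_synchronizing M \<alpha> \<longleftrightarrow> (\<lambda>n. max_norm (outcome M \<alpha> n)) \<longlonglongrightarrow> 1"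
proof
  let ?X = "\<lambda>n. max_norm (outcome M \<alpha> n)"
  assume "strongly_synchronizing M \<alpha>"
  then have *: "liminf (\<lambda>n. ereal (?X n)) = 1" by (simp add: strongly_synchronizing_def)
  have "eventually (\<lambda>n. y < ?X n) sequentially" if "y < 1" for y
    using less_LiminfD[of "ereal y" sequentially "\<lambda>n. ereal (?X n)"] that unfolding * by simp
  then show "?X \<longlonglongrightarrow> 1"
    by (intro order_tendstoI) (auto intro: max_norm_outcome_le_1 order.strict_trans1 always_eventually)
next
  assume "(\<lambda>n. max_norm (outcome M \<alpha> n)) \<longlonglongrightarrow> 1"
  then have "(\<lambda>n. ereal (max_norm (outcome M \<alpha> n))) \<longlonglongrightarrow> ereal 1" by (simp only: tendsto_ereal)
  then show "strongly_synchronizing M \<alpha>"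
    by (simp add: strongly_synchronizing_def lim_imp_Liminf one_ereal_def)
qed

section \<open>Sequences of letters\<close>

text \<open>Infinite sequences of letters stand in for finite words: dropping a prefix becomes an
  index shift, and only the first \<open>n\<close> letters matter by
  \<open>post_seq_cong\<close>.\<close>

primrec post_seq :: "('l, 'a) mdp \<Rightarrow> (nat \<Rightarrow> 'l \<Rightarrow> 'a) \<Rightarrow> 'l set \<Rightarrow> nat \<Rightarrow> 'l set" where
  "post_seq M f T 0 = T"
| "post_seq M f T (Suc n) = cell_trans M (post_seq M f T n) (f n)"

lemma post_seq_cong:
  "(\<And>i. i < n \<Longrightarrow> f i = g i) \<Longrightarrow> post_seq M f T n = post_seq M g T n"
  by (induction n) auto

lemma post_seq_add:
  "post_seq M f T (m + n) = post_seq M (\<lambda>i. f (m + i)) (post_seq M f T m) n"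
  by (induction n) auto

lemma post_seq_mono: "S \<subseteq> T \<Longrightarrow> post_seq M f S n \<subseteq> post_seq M f T n"
  by (induction n) (auto simp: cell_trans_def)

lemma post_seq_nonempty: "T \<noteq> {} \<Longrightarrow> post_seq M f T n \<noteq> {}"
  by (induction n) (auto simp: cell_trans_def Post_def set_pmf_not_empty)

lemma post_seq_UN: "post_seq M f T n = (\<Union>l\<in>T. post_seq M f {l} n)"
  by (induction n) (auto simp: cell_trans_def)

lemma post_seq_Suc_left:
  "post_seq M f T (Suc n) = post_seq M (\<lambda>i. f (Suc i)) (cell_trans M T (f 0)) n"
  using post_seq_add[of M f T 1 n] by simp

lemma reachable_cell_iff: "reachable_cell M s \<longleftrightarrow> (\<exists>f n. s = post_seq M f (init_cell M) n)"
proof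
  assume "reachable_cell M s"
  then show "\<exists>f n. s = post_seq M f (init_cell M) n"
    unfolding reachable_cell_def
  proof (induction rule: rtranclp_induct)
    case base
    show ?case by (intro exI[of _ undefined] exI[of _ 0]) simp
  next
    case (step s s')
    then obtain f n g where "s = post_seq M f (init_cell M) n" "s' = cell_trans M s g" by blast
    \<comment> \<open>Overwriting letter \<open>n\<close> does not disturb the first
      \<open>n\<close> steps, so \<open>g\<close> can be appended.\<close>
    moreover have "post_seq M (f(n := g)) (init_cell M) n = post_seq M f (init_cell M) n"
      by (rule post_seq_cong) auto
    ultimately show ?case
      by (intro exI[of _ "f(n := g)"] exI[of _ "Suc n"]) (simp del: fun_upd_apply add: fun_upd_same)
  qed
next
  assume "\<exists>f n. s = post_seq M f (init_cell M) n"
  then obtain f n where s: "s = post_seq M f (init_cell M) n" by blast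
  show "reachable_cell M s" unfolding s
  proof (induction n)
    case (Suc n)
    then show ?case unfolding reachable_cell_def
      by (rule rtranclp.rtrancl_into_rtrancl) auto
  qed (simp add: reachable_cell_def)
qed

section \<open>The Markov chain driven by a sequence of letters\<close>

primrec evolve :: "('l, 'a) mdp \<Rightarrow> (nat \<Rightarrow> 'l \<Rightarrow> 'a) \<Rightarrow> 'l pmf \<Rightarrow> nat \<Rightarrow> 'l pmf" where
  "evolve M f \<mu> 0 = \<mu>"
| "evolve M f \<mu> (Suc n) = bind_pmf (evolve M f \<mu> n) (\<lambda>l. trans M l (f n l))"

lemma set_evolve: "set_pmf (evolve M f \<mu> n) = post_seq M f (set_pmf \<mu>) n"
  by (induction n) (auto simp: cell_trans_def Post_def)

lemma evolve_add: "evolve M f \<mu> (m + n) = evolve M (\<lambda>i. f (m + i)) (evolve M f \<mu> m) n"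
  by (induction n) auto

lemma evolve_bind: "evolve M f \<mu> n = bind_pmf \<mu> (\<lambda>l. evolve M f (return_pmf l) n)"
  by (induction n) (auto simp: bind_return_pmf' bind_assoc_pmf)

lemma pmf_bind_finite:
  fixes \<mu> :: "'l::finite pmf"
  shows "pmf (bind_pmf \<mu> k) y = (\<Sum>l\<in>UNIV. pmf \<mu> l * pmf (k l) y)"
  by (simp add: pmf_bind integral_measure_pmf_real[of UNIV] mult.commute)

text \<open>Memory is reduced to a step counter; this turns a sequence of letters of the subset
  construction into a strategy of the MDP.\<close>

definition counting_strategy :: "(nat \<Rightarrow> 'l \<Rightarrow> 'a) \<Rightarrow> ('l, 'a) strategy" where
  "counting_strategy f h = return_pmf (f (run_length h) (last_state h))"

lemma outcome_counting_strategy: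
  fixes M :: "('l::finite, 'a::finite) mdp"
  shows "outcome M (counting_strategy f) n l = pmf (evolve M f (init M) n) l"
proof (induction n arbitrary: l)
  case (Suc n)
  \<comment> \<open>The action depends only on time and last state, so all flow out of a state runs
    through one action.\<close>
  have flow: "flow M (counting_strategy f) n l \<sigma> =
      (if \<sigma> = f n l then pmf (evolve M f (init M) n) l else 0)" for l \<sigma>
    unfolding Suc.IH[symmetric] outcome_eq_sum_runs flow_def
    by (auto simp: counting_strategy_def intro!: sum.cong sum.neutral)
  have "(\<Sum>\<sigma>\<in>UNIV. flow M (counting_strategy f) n k \<sigma> * pmf (trans M k \<sigma>) l) =
      (\<Sum>\<sigma>\<in>UNIV. if \<sigma> = f n k then pmf (evolve M f (init M) n) k * pmf (trans M k \<sigma>) l else 0)" for k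
    by (intro sum.cong) (auto simp: flow)
  then show ?case by (simp add: outcome_Suc pmf_bind_finite)
qed (simp add: outcome_0)

section \<open>Minimal recurrent cyclic sets\<close>

text \<open>The conditions on a recurrent cyclic set expressed through \<open>g_0\<close> alone: a
  nonempty part of the first cell that is fixed by one round of the cycle.\<close>

definition recurrent_base :: "('l, 'a) mdp \<Rightarrow> ('l, 'a) cell_path \<Rightarrow> 'l set \<Rightarrow> bool" where
  "recurrent_base M C T \<longleftrightarrow>
     T \<noteq> {} \<and> T \<subseteq> fst C ! 0 \<and> post_seq M ((!) (snd C)) T (length (snd C)) = T"

definition orbit_list :: "('l, 'a) mdp \<Rightarrow> ('l, 'a) cell_path \<Rightarrow> 'l set \<Rightarrow> 'l set list" where
  "orbit_list M C T = map (post_seq M ((!) (snd C)) T) [0..<length (snd C) + 1]"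

lemma length_orbit_list [simp]: "length (orbit_list M C T) = length (snd C) + 1"
  by (simp add: orbit_list_def)

lemma nth_orbit_list [simp]:
  "i \<le> length (snd C) \<Longrightarrow> orbit_list M C T ! i = post_seq M ((!) (snd C)) T i"
  unfolding orbit_list_def by (subst nth_map) (simp_all del: upt_Suc)

lemma orbit_list_0: "orbit_list M C T ! 0 = T"
  by simp

lemma cycle_length: "is_cycle M C \<Longrightarrow> length (snd C) > 0"
  by (auto simp: is_cycle_def)

lemma cycle_nth:
  assumes "is_cycle M C" "i \<le> length (snd C)"
  shows "fst C ! i = post_seq M ((!) (snd C)) (fst C ! 0) i"
  using assms(2)
proof (induction i)
  case (Suc i)
  from assms(1) have "\<forall>j < length (snd C). cell_trans M (fst C ! j) (snd C ! j) = fst C ! (j + 1)"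
    by (cases C) (simp add: is_cycle_def)
  with Suc.prems have "fst C ! Suc i = cell_trans M (fst C ! i) (snd C ! i)" by simp
  with Suc show ?case by simp
qed simp

lemma cycle_base:
  "is_cycle M C \<Longrightarrow> post_seq M ((!) (snd C)) (fst C ! 0) (length (snd C)) = fst C ! 0"
  using cycle_nth[of M C "length (snd C)"] by (simp add: is_cycle_def split: prod.splits)

text \<open>Each component is the image of the previous one, so the first determines all.
  Conversely, inclusion in the cells follows from monotonicity, and no component is empty because
  every state has a successor.\<close>

lemma recurrent_cyclic_set_iff:
  assumes "is_cycle M C"
  shows "recurrent_cyclic_set M C G \<longleftrightarrow> recurrent_base M C (G ! 0) \<and> G = orbit_list M C (G ! 0)"
proof -
  obtain ss fs where C: "C = (ss, fs)" by (cases C)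
  have d: "0 < length fs" using cycle_length[OF assms] by (simp add: C)
  have ss: "ss ! i = post_seq M ((!) fs) (ss ! 0) i" if "i \<le> length fs" for i
    using cycle_nth[OF assms, of i] that by (simp add: C)
  show ?thesis
  proof
    assume R: "recurrent_cyclic_set M C G"
    then have st': "G ! Suc i = cell_trans M (G ! i) (fs ! i)" if "i < length fs" for i
      using that by (simp add: recurrent_cyclic_set_def C cell_trans_def)
    have G: "G ! i = post_seq M ((!) fs) (G ! 0) i" if "i \<le> length fs" for i
      using that
    proof (induction i)
      case (Suc i)
      then show ?case using st'[of i] by simp
    qed simp
    have "G = orbit_list M C (G ! 0)"
    proof (rule nth_equalityI)
      show "length G = length (orbit_list M C (G ! 0))"
        using R by (simp add: recurrent_cyclic_set_def C)
      show "G ! i = orbit_list M C (G ! 0) ! i" if "i < length G" for i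
      proof -
        have i: "i \<le> length fs" using that R by (simp add: recurrent_cyclic_set_def C)
        then show ?thesis using G[OF i] by (simp add: C)
      qed
    qed
    moreover have "recurrent_base M C (G ! 0)"
    proof -
      \<comment> \<open>Nonemptiness and inclusion are imposed only at indices below the number of
        letters; a cycle has a letter, so index 0 is covered.\<close>
      from d have *: "G ! 0 \<noteq> {}" "G ! 0 \<subseteq> ss ! 0" "G ! 0 = G ! length fs"
        using R unfolding recurrent_cyclic_set_def C prod.case by blast+
      have "post_seq M ((!) fs) (G ! 0) (length fs) = G ! 0"
        using G[OF order_refl] *(3) by (rule trans[OF sym sym])
      then show ?thesis using * unfolding recurrent_base_def C by simp
    qed
    ultimately show "recurrent_base M C (G ! 0) \<and> G = orbit_list M C (G ! 0)" by blast
  next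
    assume *: "recurrent_base M C (G ! 0) \<and> G = orbit_list M C (G ! 0)"
    define T where "T = G ! 0"
    have G: "G = orbit_list M C T" using * unfolding T_def by (rule conjunct2)
    have T: "T \<noteq> {}" "T \<subseteq> ss ! 0" "post_seq M ((!) fs) T (length fs) = T"
      using conjunct1[OF *] unfolding T_def[symmetric] by (auto simp: recurrent_base_def C)
    have "post_seq M ((!) fs) T i \<subseteq> ss ! i" if "i \<le> length fs" for i
      unfolding ss[OF that] by (rule post_seq_mono[OF T(2)])
    then show "recurrent_cyclic_set M C G"
      unfolding recurrent_cyclic_set_def G
      using T(3) post_seq_nonempty[OF T(1), of M "(!) fs"]
      by (simp add: C cell_trans_def)
  qed
qed

text \<open>By monotonicity, componentwise inclusion of orbits is the same as inclusion of their
  bases, and distinct bases have distinct orbits; minimality therefore transfers to bases.\<close>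

lemma \<Delta>_eq:
  assumes "is_cycle M C"
  shows "\<Delta> M C = orbit_list M C `
     {T. recurrent_base M C T \<and> (\<forall>T'. recurrent_base M C T' \<longrightarrow> T' \<subseteq> T \<longrightarrow> T' = T)}"
proof -
  have sub: "(\<forall>i < length (snd C). orbit_list M C S ! i \<subseteq> orbit_list M C T ! i) \<longleftrightarrow> S \<subseteq> T" for S T
  proof
    assume "\<forall>i < length (snd C). orbit_list M C S ! i \<subseteq> orbit_list M C T ! i"
    then have "orbit_list M C S ! 0 \<subseteq> orbit_list M C T ! 0"
      by (rule allE[of _ 0]) (use cycle_length[OF assms] in simp)
    then show "S \<subseteq> T" unfolding orbit_list_0 .
  qed (auto dest: post_seq_mono)
  have rc: "recurrent_cyclic_set M C G \<longleftrightarrow> (\<exists>T. recurrent_base M C T \<and> G = orbit_list M C T)" for G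
    unfolding recurrent_cyclic_set_iff[OF assms] by (metis orbit_list_0)
  have inj: "orbit_list M C S = orbit_list M C T \<longleftrightarrow> S = T" for S T by (metis orbit_list_0)
  have "minimal_recurrent_cyclic_set M C G \<longleftrightarrow> (\<exists>T. G = orbit_list M C T \<and> recurrent_base M C T \<and>
     (\<forall>T'. recurrent_base M C T' \<longrightarrow> T' \<subseteq> T \<longrightarrow> T' = T))"
    (is "?L \<longleftrightarrow> ?R") for G
  proof
    assume L: ?L
    then obtain T where T: "recurrent_base M C T" "G = orbit_list M C T"
      unfolding minimal_recurrent_cyclic_set_def rc by blast
    have "T' = T" if "recurrent_base M C T'" "T' \<subseteq> T" for T'
    proof -
      have "recurrent_cyclic_set M C (orbit_list M C T')" using that(1) rc by blast
      moreover have "\<forall>i < length (snd C). orbit_list M C T' ! i \<subseteq> G ! i"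
        using that(2) unfolding T(2) sub .
      ultimately have "orbit_list M C T' = G"
        using L unfolding minimal_recurrent_cyclic_set_def by blast
      then show ?thesis unfolding T(2) inj .
    qed
    then show ?R using T by blast
  next
    assume ?R
    then obtain T where T: "recurrent_base M C T" "G = orbit_list M C T"
      and min: "\<And>T'. recurrent_base M C T' \<Longrightarrow> T' \<subseteq> T \<Longrightarrow> T' = T" by blast
    have "G' = G" if G': "recurrent_cyclic_set M C G'" "\<forall>i < length (snd C). G' ! i \<subseteq> G ! i" for G'
    proof -
      obtain T' where T': "recurrent_base M C T'" "G' = orbit_list M C T'"
        using G'(1) unfolding rc by blast
      have "T' \<subseteq> T" using G'(2) unfolding T(2) T'(2) sub .
      then show ?thesis using min[OF T'(1)] T(2) T'(2) by blast
    qed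
    then show ?L unfolding minimal_recurrent_cyclic_set_def using T rc by blast
  qed
  then show ?thesis unfolding \<Delta>_def by blast
qed

text \<open>Take a nonempty subset of \<open>S\<close> of least cardinality that one round maps into
  itself. Its image has the same property and lies inside it, so it equals its image.\<close>

lemma recurrent_base_in_closed_set:
  fixes M :: "('l::finite, 'a) mdp"
  assumes "S \<noteq> {}" "S \<subseteq> fst C ! 0" and "post_seq M ((!) (snd C)) S (length (snd C)) \<subseteq> S"
  obtains T where "recurrent_base M C T" "T \<subseteq> S"
    "\<And>T'. recurrent_base M C T' \<Longrightarrow> T' \<subseteq> T \<Longrightarrow> T' = T"
proof -
  let ?F = "\<lambda>T. post_seq M ((!) (snd C)) T (length (snd C))"
  let ?P = "\<lambda>T. T \<noteq> {} \<and> T \<subseteq> S \<and> ?F T \<subseteq> T"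
  obtain T where T: "?P T" and min: "\<And>T'. ?P T' \<Longrightarrow> card T \<le> card T'"
    using ex_has_least_nat[of ?P S card] assms by blast
  have min': "T' = T" if "?P T'" "T' \<subseteq> T" for T'
    using min[OF that(1)] that(2) by (simp add: card_seteq)
  have "?F T = T"
  proof (rule min')
    have "?F T \<noteq> {}" using T post_seq_nonempty by blast
    moreover have "?F (?F T) \<subseteq> ?F T" using T by (intro post_seq_mono) auto
    ultimately show "?P (?F T)" using T by blast
  qed (use T in blast)
  then have "recurrent_base M C T" using T assms(2) by (auto simp: recurrent_base_def)
  moreover have "T' = T" if "recurrent_base M C T'" "T' \<subseteq> T" for T'
    using that T by (intro min') (auto simp: recurrent_base_def)
  ultimately show ?thesis using T that by blast
qed

text \<open>The last conjunct encodes uniqueness: if every recurrent base contains \<open>x\<close>,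
  then \<open>{x}\<close> is the only minimal one.\<close>

definition synchronizing_base :: "('l, 'a) mdp \<Rightarrow> ('l, 'a) cell_path \<Rightarrow> 'l \<Rightarrow> bool" where
  "synchronizing_base M C x \<longleftrightarrow> recurrent_base M C {x} \<and>
     (\<forall>i \<le> length (snd C). card (post_seq M ((!) (snd C)) {x} i) = 1) \<and>
     (\<forall>T. recurrent_base M C T \<longrightarrow> x \<in> T)"

lemma synchronizing_cycle_iff:
  fixes M :: "('l::finite, 'a) mdp"
  assumes "is_cycle M C"
  shows "card (\<Delta> M C) = 1 \<and> (\<forall>G \<in> \<Delta> M C. \<forall>i < length G. card (G ! i) = 1) \<longleftrightarrow>
     (\<exists>x. synchronizing_base M C x)" (is "?L \<longleftrightarrow> ?R")
proof
  assume L: ?L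
  then obtain G where G: "\<Delta> M C = {G}" by (auto simp: card_1_singleton_iff)
  then obtain T where T: "G = orbit_list M C T" "recurrent_base M C T"
    using \<Delta>_eq[OF assms] by blast
  have sing: "card (post_seq M ((!) (snd C)) T i) = 1" if "i \<le> length (snd C)" for i
    using L that by (auto simp: G T(1))
  then obtain x where x: "T = {x}" using sing[of 0] by (auto simp: card_1_singleton_iff)
  have "x \<in> S" if S: "recurrent_base M C S" for S
  proof -
    \<comment> \<open>Below any recurrent base lies a minimal one, which by uniqueness is
      \<open>{x}\<close>.\<close>
    obtain U where U: "recurrent_base M C U" "U \<subseteq> S"
      "\<And>T'. recurrent_base M C T' \<Longrightarrow> T' \<subseteq> U \<Longrightarrow> T' = U"
      using S recurrent_base_in_closed_set[of S C M] by (auto simp: recurrent_base_def)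
    then have "orbit_list M C U \<in> \<Delta> M C" unfolding \<Delta>_eq[OF assms] by blast
    then have "U = T" unfolding G T(1) by (metis orbit_list_0 singletonD)
    then show ?thesis using U(2) x by blast
  qed
  then show ?R using T(2) sing unfolding synchronizing_base_def x by blast
next
  assume ?R
  then obtain x where x: "recurrent_base M C {x}" "\<And>T. recurrent_base M C T \<Longrightarrow> x \<in> T"
      "\<And>i. i \<le> length (snd C) \<Longrightarrow> card (post_seq M ((!) (snd C)) {x} i) = 1"
    unfolding synchronizing_base_def by blast
  have "T' = {x}" if "recurrent_base M C T'" "T' \<subseteq> {x}" for T'
    using that x(2) by blast
  with x(1,2) have "{T. recurrent_base M C T \<and> (\<forall>T'. recurrent_base M C T' \<longrightarrow> T' \<subseteq> T \<longrightarrow> T' = T)} = {{x}}"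
    by blast
  then have "\<Delta> M C = {orbit_list M C {x}}" using \<Delta>_eq[OF assms] by simp
  then show ?L using x(3) by simp
qed

lemma post_seq_periodic:
  assumes "post_seq M f S d = S" "\<And>i. f (d + i) = f i"
  shows "post_seq M f S (m * d + i) = post_seq M f S i"
proof (induction m)
  case (Suc m)
  have "post_seq M f S (d + (m * d + i)) = post_seq M f S (m * d + i)"
    by (subst post_seq_add) (simp add: assms)
  then show ?case using Suc by (simp add: add.assoc)
qed simp

section \<open>From a cycle to a strategy\<close>

text \<open>In the chain sampled every \<open>N\<close> steps, \<open>x\<close> is absorbing and
  every state of the support enters it with probability at least \<open>\<epsilon>\<close>. The mass
  outside \<open>x\<close> thus shrinks by the factor \<open>1 - \<epsilon>\<close> per
  round.\<close>

lemma evolve_absorbed: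
  fixes M :: "('l::finite, 'a) mdp"
  assumes periodic: "\<And>i. f (N + i) = f i"
    and S: "post_seq M f (set_pmf \<mu>) N = set_pmf \<mu>"
    and x: "post_seq M f {x} N = {x}"
    and reach: "\<And>l. l \<in> set_pmf \<mu> \<Longrightarrow> x \<in> post_seq M f {l} N"
  shows "(\<lambda>m. pmf (evolve M f \<mu> (m * N)) x) \<longlonglongrightarrow> 1"
proof -
  define D where "D m = evolve M f \<mu> (m * N)" for m
  define q where "q l = pmf (evolve M f (return_pmf l) N) x" for l
  define \<epsilon> where "\<epsilon> = Min (q ` set_pmf \<mu>)"
  have f: "f (m * N + i) = f i" for m i
    by (induction m) (simp_all add: periodic add.assoc)
  have D_Suc: "D (Suc m) = evolve M f (D m) N" for m
    using evolve_add[of M f \<mu> "m * N" N] unfolding D_def f by (simp add: add.commute)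
  have set_D: "set_pmf (D m) = set_pmf \<mu>" for m
  proof (induction m)
    case (Suc m)
    then show ?case by (simp add: D_Suc set_evolve S)
  qed (simp add: D_def)
  have q_pos: "q l > 0" if "l \<in> set_pmf \<mu>" for l
    using reach[OF that] by (simp add: q_def pmf_positive_iff set_evolve)
  have q_x: "q x = 1"
    using x set_pmf_subset_singleton[of "evolve M f (return_pmf x) N" x]
    by (simp add: q_def set_evolve)
  have \<epsilon>_pos: "\<epsilon> > 0"
    unfolding \<epsilon>_def using q_pos by (subst Min_gr_iff) (auto simp: set_pmf_not_empty)
  have \<epsilon>_le: "\<epsilon> \<le> q l" if "l \<in> set_pmf \<mu>" for l
    unfolding \<epsilon>_def using that by simp
  have \<epsilon>_le_1: "\<epsilon> \<le> 1"
  proof -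
    obtain l where "l \<in> set_pmf \<mu>" using set_pmf_not_empty[of \<mu>] by blast
    from \<epsilon>_le[OF this] show ?thesis by (simp add: q_def order.trans[OF _ pmf_le_1])
  qed
  have step: "1 - pmf (D (Suc m)) x \<le> (1 - \<epsilon>) * (1 - pmf (D m) x)" for m
  proof -
    \<comment> \<open>On the support \<open>q l\<close> is at least \<open>\<epsilon>\<close>, and
      at \<open>x\<close> it is 1. So all mass contributes a share \<open>\<epsilon>\<close>, and
      the mass at \<open>x\<close> contributes a further \<open>1 - \<epsilon>\<close>.\<close>
    have "pmf (D m) x * (1 - \<epsilon>) + \<epsilon> =
        (\<Sum>l\<in>UNIV. (if l = x then pmf (D m) x * (1 - \<epsilon>) else 0) + pmf (D m) l * \<epsilon>)"
      by (simp add: sum.distrib sum_distrib_right[symmetric] sum_pmf_eq_1)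
    also have "\<dots> \<le> (\<Sum>l\<in>UNIV. pmf (D m) l * q l)"
    proof (rule sum_mono)
      fix l
      have "pmf (D m) l * \<epsilon> \<le> pmf (D m) l * q l"
      proof (cases "l \<in> set_pmf \<mu>")
        case True
        then show ?thesis by (intro mult_left_mono \<epsilon>_le) auto
      next
        case False
        then have "l \<notin> set_pmf (D m)" by (simp only: set_D not_False_eq_True)
        then have "pmf (D m) l = 0" by (simp only: set_pmf_iff not_not)
        then show ?thesis by simp
      qed
      then show "(if l = x then pmf (D m) x * (1 - \<epsilon>) else 0) + pmf (D m) l * \<epsilon> \<le> pmf (D m) l * q l"
        by (auto simp: q_x algebra_simps)
    qed
    also have "\<dots> = pmf (D (Suc m)) x"
      unfolding D_Suc by (subst evolve_bind) (simp add: pmf_bind_finite q_def)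
    finally show ?thesis by (simp add: algebra_simps)
  qed
  have bound: "1 - pmf (D m) x \<le> (1 - \<epsilon>) ^ m" for m
  proof (induction m)
    case (Suc m)
    have "(1 - \<epsilon>) * (1 - pmf (D m) x) \<le> (1 - \<epsilon>) * (1 - \<epsilon>) ^ m"
      using Suc \<epsilon>_le_1 by (intro mult_left_mono) auto
    then show ?case using step[of m] by simp
  qed simp
  have lim0: "(\<lambda>m. (1 - \<epsilon>) ^ m) \<longlonglongrightarrow> 0"
    using \<epsilon>_pos \<epsilon>_le_1 by (intro LIMSEQ_realpow_zero) auto
  have "(\<lambda>m. 1 - pmf (D m) x) \<longlonglongrightarrow> 0"
    by (rule tendsto_sandwich[OF _ _ tendsto_const lim0]) (simp_all add: bound pmf_le_1)
  from tendsto_diff[OF tendsto_const[of 1] this] show ?thesis by (simp add: D_def)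
qed

text \<open>The states of the first cell that never hit \<open>x\<close> after whole rounds form a
  set \<open>S\<close> that a round maps into itself. If nonempty, \<open>S\<close> contains a
  recurrent base, hence \<open>x\<close>.\<close>

lemma synchronizing_base_reached:
  fixes M :: "('l::finite, 'a) mdp"
  assumes C: "is_cycle M C" and x: "synchronizing_base M C x"
    and f: "\<And>i. i < length (snd C) \<Longrightarrow> f i = snd C ! i" "\<And>i. f (length (snd C) + i) = f i"
    and l: "l \<in> fst C ! 0"
  shows "\<exists>m. x \<in> post_seq M f {l} (m * length (snd C))"
proof (rule ccontr)
  let ?d = "length (snd C)"
  define S where "S = {l \<in> fst C ! 0. \<forall>m. x \<notin> post_seq M f {l} (m * ?d)}"
  assume "\<not> ?thesis"
  with l have "S \<noteq> {}" by (auto simp: S_def)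
  moreover have "S \<subseteq> fst C ! 0" by (auto simp: S_def)
  moreover have F: "post_seq M ((!) (snd C)) T ?d = post_seq M f T ?d" for T
    by (rule post_seq_cong) (simp add: f(1))
  moreover have "post_seq M f S ?d \<subseteq> S"
  proof
    fix l' assume "l' \<in> post_seq M f S ?d"
    then obtain l where l: "l \<in> S" "l' \<in> post_seq M f {l} ?d"
      by (subst (asm) post_seq_UN) blast
    have "post_seq M f (fst C ! 0) ?d = fst C ! 0"
      using cycle_base[OF C] F by simp
    then have "l' \<in> fst C ! 0"
      using l post_seq_mono[of "{l}" "fst C ! 0" M f ?d] by (auto simp: S_def)
    moreover have "x \<notin> post_seq M f {l'} (m * ?d)" for m
    proof
      assume "x \<in> post_seq M f {l'} (m * ?d)"
      then have "x \<in> post_seq M f (post_seq M f {l} ?d) (m * ?d)"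
        using l(2) post_seq_mono[of "{l'}" "post_seq M f {l} ?d"] by blast
      then have "x \<in> post_seq M f {l} (Suc m * ?d)"
        using post_seq_add[of M f "{l}" ?d "m * ?d"] by (simp add: f(2))
      then show False using l(1) unfolding S_def by blast
    qed
    ultimately show "l' \<in> S" by (simp add: S_def)
  qed
  ultimately obtain T where "recurrent_base M C T" "T \<subseteq> S"
    using recurrent_base_in_closed_set[of S C M] by metis
  then have "x \<in> S" using x by (auto simp: synchronizing_base_def)
  \<comment> \<open>Contradiction: \<open>x\<close> hits itself after zero rounds.\<close>
  then have "x \<notin> post_seq M f {x} (0 * ?d)" unfolding S_def by blast
  then show False by simp
qed

text \<open>Play \<open>g\<close> until the first cell of the cycle is reached, then repeat its
  letters forever. The mass gathers in \<open>x\<close> at multiples of \<open>N\<close>, and in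
  between it moves as one block, because the orbit of \<open>x\<close> consists of
  singletons.\<close>

lemma cycle_imp_synchronizing:
  fixes M :: "('l::finite, 'a::finite) mdp"
  assumes acc: "accessible_cycle M C" and x: "synchronizing_base M C x"
  shows "\<exists>\<alpha> :: ('l, 'a) strategy. strongly_synchronizing M \<alpha>"
proof -
  have C: "is_cycle M C" and "reachable_cell M (fst C ! 0)"
    using acc by (auto simp: accessible_cycle_def)
  then obtain g k where k: "fst C ! 0 = post_seq M g (init_cell M) k"
    unfolding reachable_cell_iff by blast
  define d where "d = length (snd C)"
  have d: "d > 0" using cycle_length[OF C] by (simp add: d_def)
  define f where "f i = snd C ! (i mod d)" for i
  have f: "f i = snd C ! i" if "i < d" for i using that by (simp add: f_def)
  have f_per: "f (d + i) = f i" for i by (simp add: f_def)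
  have f_per': "f (m * d + i) = f i" for m i by (simp add: f_def)
  have post_d: "post_seq M f T i = post_seq M ((!) (snd C)) T i" if "i \<le> d" for T i
    using that by (intro post_seq_cong) (simp add: f)
  have x_d: "post_seq M f {x} d = {x}"
    using x by (simp add: post_d synchronizing_base_def recurrent_base_def d_def)
  have S_d: "post_seq M f (fst C ! 0) d = fst C ! 0"
    using cycle_base[OF C] by (simp add: post_d d_def)
  have x_md: "post_seq M f {x} (m * d) = {x}" for m
    using post_seq_periodic[of M f "{x}" d m 0] x_d f_per by simp
  have S_md: "post_seq M f (fst C ! 0) (m * d) = fst C ! 0" for m
    using post_seq_periodic[of M f "fst C ! 0" d m 0] S_d f_per by simp
  have sing: "\<exists>y. post_seq M f {x} i = {y}" for i
  proof -
    have "post_seq M f {x} i = post_seq M f {x} (i div d * d + i mod d)" by simp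
    also have "\<dots> = post_seq M f {x} (i mod d)"
      using x_d f_per by (rule post_seq_periodic)
    also have "\<dots> = post_seq M ((!) (snd C)) {x} (i mod d)"
      using d by (intro post_d) simp
    also have "card \<dots> = 1"
      using x d unfolding synchronizing_base_def d_def by (simp add: less_imp_le)
    finally show ?thesis by (simp add: card_1_singleton_iff)
  qed
  obtain m where m: "\<And>l. l \<in> fst C ! 0 \<Longrightarrow> x \<in> post_seq M f {l} (m l * d)"
    using synchronizing_base_reached[OF C x, of f] f f_per unfolding d_def by metis
  \<comment> \<open>Since \<open>x\<close> returns to itself after each round, a state that hits it
    after \<open>m l\<close> rounds can also do so after any larger number; the maximum serves all
    states at once.\<close>
  define m0 where "m0 = Max (range m)"
  define N where "N = m0 * d"
  have reach: "x \<in> post_seq M f {l} N" if "l \<in> fst C ! 0" for l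
  proof -
    have "m l \<le> m0" by (simp add: m0_def)
    then have N: "N = m l * d + (m0 - m l) * d" by (simp add: N_def add_mult_distrib[symmetric])
    have "post_seq M f {x} ((m0 - m l) * d) \<subseteq> post_seq M f (post_seq M f {l} (m l * d)) ((m0 - m l) * d)"
      using m[OF that] by (intro post_seq_mono) auto
    then show ?thesis unfolding N post_seq_add[of M f "{l}" "m l * d"] f_per' x_md by blast
  qed
  define \<gamma> where "\<gamma> n = (if n < k then g n else f (n - k))" for n
  define \<mu> where "\<mu> = evolve M \<gamma> (init M) k"
  have \<mu>: "set_pmf \<mu> = fst C ! 0"
    unfolding \<mu>_def set_evolve k init_cell_def by (rule post_seq_cong) (simp add: \<gamma>_def)
  have lim: "(\<lambda>m. pmf (evolve M f \<mu> (m * N)) x) \<longlonglongrightarrow> 1"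
  proof (rule evolve_absorbed)
    show "f (N + i) = f i" for i by (simp add: N_def f_per')
    show "post_seq M f (set_pmf \<mu>) N = set_pmf \<mu>" by (simp add: \<mu> N_def S_md)
    show "post_seq M f {x} N = {x}" by (simp add: N_def x_md)
    show "x \<in> post_seq M f {l} N" if "l \<in> set_pmf \<mu>" for l using that \<mu> reach by simp
  qed
  \<comment> \<open>The mass in \<open>x\<close> after \<open>m * N\<close> steps on the cycle is
    carried jointly to a single state at every later time, so it bounds all later norms from
    below.\<close>
  let ?X = "outcome M (counting_strategy \<gamma>)"
  have mass: "pmf (evolve M f \<mu> (m * N)) x \<le> max_norm (?X n)" if "n \<ge> k + m * N" for m n
  proof -
    define r where "r = n - k - m * N"
    have n: "n = k + (m * N + r)" using that by (simp add: r_def)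
    obtain y where y: "post_seq M f {x} r = {y}" using sing by blast
    let ?D = "evolve M f \<mu> (m * N)"
    have "pmf (evolve M f (return_pmf x) r) y = 1"
      using y set_pmf_subset_singleton[of "evolve M f (return_pmf x) r" y]
      by (simp add: set_evolve)
    then have "pmf ?D x = pmf ?D x * pmf (evolve M f (return_pmf x) r) y" by simp
    also have "\<dots> \<le> (\<Sum>l\<in>UNIV. pmf ?D l * pmf (evolve M f (return_pmf l) r) y)"
      by (rule member_le_sum) auto
    also have "\<dots> = pmf (evolve M f ?D r) y"
      by (subst (2) evolve_bind) (simp add: pmf_bind_finite)
    also have "evolve M f ?D r = evolve M f \<mu> (m * N + r)"
      using f_per'[of "m * m0"] by (simp add: evolve_add N_def mult.assoc)
    also have "\<dots> = evolve M \<gamma> (init M) n"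
      unfolding n evolve_add[of M \<gamma> _ k] \<mu>_def by (simp add: \<gamma>_def)
    also have "pmf \<dots> y = ?X n y" by (simp add: outcome_counting_strategy)
    also have "\<dots> \<le> max_norm (?X n)" by (rule max_norm_ge)
    finally show ?thesis .
  qed
  have "(\<lambda>n. max_norm (?X n)) \<longlonglongrightarrow> 1"
  proof (rule order_tendstoI)
    fix a :: real assume "a < 1"
    then have "eventually (\<lambda>m. a < pmf (evolve M f \<mu> (m * N)) x) sequentially"
      by (rule order_tendstoD(1)[OF lim])
    from eventually_happens[OF this] obtain m where "a < pmf (evolve M f \<mu> (m * N)) x" by auto
    then have "a < max_norm (?X n)" if "n \<ge> k + m * N" for n
      using mass[OF that] by (rule order.strict_trans2)
    then show "eventually (\<lambda>n. a < max_norm (?X n)) sequentially"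
      by (rule eventually_sequentiallyI)
  next
    fix a :: real assume "1 < a"
    then show "eventually (\<lambda>n. max_norm (?X n) < a) sequentially"
      by (intro always_eventually allI) (rule order.strict_trans1[OF max_norm_outcome_le_1])
  qed
  then show ?thesis unfolding strongly_synchronizing_iff_tendsto by blast
qed

section \<open>From a strategy to a cycle\<close>

text \<open>Only finitely many transition probabilities are positive, so a least one exists.\<close>

lemma transition_prob_lower_bound:
  fixes M :: "('l::finite, 'a::finite) mdp"
  obtains p where "p > 0" "p \<le> 1" "\<And>l \<sigma> l'. l' \<in> Post M \<sigma> l \<Longrightarrow> p \<le> pmf (trans M l \<sigma>) l'"
proof -
  define A where "A = (\<lambda>(l, \<sigma>, l'). pmf (trans M l \<sigma>) l') ` {(l, \<sigma>, l'). l' \<in> Post M \<sigma> l}"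
  have fin: "finite A" unfolding A_def by (rule finite_imageI) simp
  obtain l' where "l' \<in> Post M undefined undefined"
    using set_pmf_not_empty[of "trans M undefined undefined"] unfolding Post_def by blast
  then have ne: "A \<noteq> {}" unfolding A_def by blast
  have "Min A \<in> A" using fin ne by (rule Min_in)
  then have "Min A > 0" "Min A \<le> 1" by (auto simp: A_def Post_def pmf_positive pmf_le_1)
  moreover have "Min A \<le> pmf (trans M l \<sigma>) l'" if "l' \<in> Post M \<sigma> l" for l \<sigma> l'
    using that by (intro Min_le fin) (force simp: A_def)
  ultimately show ?thesis using that by blast
qed

lemma outcome_sum_le_1: "sum (outcome M \<alpha> n) A \<le> 1"
  unfolding sum_outcome[of M \<alpha> n, symmetric] by (rule sum_mono2) (auto simp: outcome_nonneg)

text \<open>If almost all mass sits in \<open>t n\<close> and then in \<open>t (n + 1)\<close>, an action carrying at least an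
  average share of the flow out of \<open>t n\<close> cannot leak even the smallest transition probability.\<close>

lemma dirac_action:
  fixes M :: "('l::finite, 'a::finite) mdp"
  assumes lim: "(\<lambda>n. outcome M \<alpha> n (t n)) \<longlonglongrightarrow> 1"
  shows "\<exists>n0. \<forall>n\<ge>n0. \<exists>\<sigma>. flow M \<alpha> n (t n) \<sigma> > 0 \<and> Post M \<sigma> (t n) = {t (Suc n)}"
proof -
  obtain p where p: "p > 0" "p \<le> 1" "\<And>l \<sigma> l'. l' \<in> Post M \<sigma> l \<Longrightarrow> p \<le> pmf (trans M l \<sigma>) l'"
    using transition_prob_lower_bound by metis
  define c where "c = real CARD('a)"
  have c: "c \<ge> 1" unfolding c_def by (simp add: Suc_le_eq)
  \<comment> \<open>Chosen so that a leak of at least \<open>(1 - \<epsilon>) / c * p\<close>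
    exceeds \<open>\<epsilon>\<close>: multiplied by \<open>c\<close>, the leak is at least
    \<open>3 / 4 * p\<close>, while \<open>\<epsilon> * c\<close> is only
    \<open>p / 4\<close>.\<close>
  define \<epsilon> where "\<epsilon> = p / (4 * c)"
  have \<epsilon>: "\<epsilon> > 0" "\<epsilon> * c = p / 4" using p(1) c by (auto simp: \<epsilon>_def)
  have "\<epsilon> * 1 \<le> \<epsilon> * c" using c \<epsilon>(1) by (intro mult_left_mono) auto
  then have \<epsilon>_le: "\<epsilon> \<le> 1 / 4" using \<epsilon>(2) p(2) by simp
  have "eventually (\<lambda>n. 1 - \<epsilon> < outcome M \<alpha> n (t n)) sequentially"
    using order_tendstoD(1)[OF lim, of "1 - \<epsilon>"] \<epsilon>(1) by simp
  then obtain n0 where n0: "\<And>n. n \<ge> n0 \<Longrightarrow> 1 - \<epsilon> < outcome M \<alpha> n (t n)"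
    by (auto simp: eventually_sequentially)
  have "\<exists>\<sigma>. flow M \<alpha> n (t n) \<sigma> > 0 \<and> Post M \<sigma> (t n) = {t (Suc n)}" if n: "n \<ge> n0" for n
  proof -
    have "\<exists>\<sigma>. flow M \<alpha> n (t n) \<sigma> \<ge> (1 - \<epsilon>) / c"
    proof (rule ccontr)
      assume "\<not> ?thesis"
      then have "(\<Sum>\<sigma>\<in>UNIV. flow M \<alpha> n (t n) \<sigma>) < (\<Sum>\<sigma>\<in>(UNIV::'a set). (1 - \<epsilon>) / c)"
        by (intro sum_strict_mono) (auto simp: not_le)
      also have "\<dots> = 1 - \<epsilon>" using c by (simp add: c_def)
      finally show False using n0[OF n] by (simp add: sum_flow)
    qed
    then obtain \<sigma> where \<sigma>: "flow M \<alpha> n (t n) \<sigma> \<ge> (1 - \<epsilon>) / c" by blast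
    have pos: "(1 - \<epsilon>) / c > 0" using \<epsilon>_le c by simp
    have "l' = t (Suc n)" if l': "l' \<in> Post M \<sigma> (t n)" for l'
    proof (rule ccontr)
      assume ne: "l' \<noteq> t (Suc n)"
      have "(1 - \<epsilon>) / c * p \<le> flow M \<alpha> n (t n) \<sigma> * pmf (trans M (t n) \<sigma>) l'"
        using \<sigma> p(1) p(3)[OF l'] pos by (intro mult_mono) auto
      also have "\<dots> \<le> outcome M \<alpha> (Suc n) l'" by (rule outcome_Suc_ge)
      \<comment> \<open>Beside \<open>t (Suc n)\<close>, which holds more than
        \<open>1 - \<epsilon>\<close>, any other state has less than
        \<open>\<epsilon>\<close>.\<close>
      also have "\<dots> < \<epsilon>"
        using outcome_sum_le_1[of M \<alpha> "Suc n" "{l', t (Suc n)}"] ne n0[of "Suc n"] n by simp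
      finally have "(1 - \<epsilon>) * p < \<epsilon> * c" using c by (simp add: field_simps)
      moreover have "(3 / 4) * p \<le> (1 - \<epsilon>) * p" using \<epsilon>_le p(1) by (intro mult_right_mono) auto
      ultimately show False using \<epsilon>(2) p(1) by simp
    qed
    then have "Post M \<sigma> (t n) = {t (Suc n)}"
      using set_pmf_not_empty[of "trans M (t n) \<sigma>"] unfolding Post_def by blast
    then show ?thesis using \<sigma> pos by (intro exI[of _ \<sigma>]) auto
  qed
  then show ?thesis by blast
qed

text \<open>Reachability in exactly \<open>j\<close> steps through actions that carry flow at their
  time. The target depends on time because \<open>t n\<close> moves; the step count later serves as
  a rank.\<close>

primrec flow_reaches ::
  "('l::finite, 'a::finite) mdp \<Rightarrow> ('l, 'a) strategy \<Rightarrow> (nat \<Rightarrow> 'l \<Rightarrow> bool) \<Rightarrow> nat \<Rightarrow> nat \<Rightarrow> 'l \<Rightarrow> bool" where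
  "flow_reaches M \<alpha> P 0 n l \<longleftrightarrow> P n l"
| "flow_reaches M \<alpha> P (Suc j) n l \<longleftrightarrow>
     (\<exists>\<sigma>. flow M \<alpha> n l \<sigma> > 0 \<and> (\<exists>l'\<in>Post M \<sigma> l. flow_reaches M \<alpha> P j (Suc n) l'))"

text \<open>The mass of the states that never reach \<open>t\<close> is nondecreasing, yet it is at most the mass
  outside \<open>t n\<close>, which tends to \<open>0\<close>.\<close>

lemma flow_reaches_track:
  fixes M :: "('l::finite, 'a::finite) mdp"
  assumes lim: "(\<lambda>n. outcome M \<alpha> n (t n)) \<longlonglongrightarrow> 1" and l: "outcome M \<alpha> n l > 0"
  shows "\<exists>j. flow_reaches M \<alpha> (\<lambda>n l. n0 \<le> n \<and> l = t n) j n l"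
proof (rule ccontr)
  let ?R = "flow_reaches M \<alpha> (\<lambda>n l. n0 \<le> n \<and> l = t n)"
  define B where "B n = {l. \<forall>j. \<not> ?R j n l}" for n
  define b where "b n = sum (outcome M \<alpha> n) (B n)" for n
  have closed: "Post M \<sigma> l \<subseteq> B (Suc n)" if "l \<in> B n" "flow M \<alpha> n l \<sigma> > 0" for n l \<sigma>
  proof
    fix l' assume l': "l' \<in> Post M \<sigma> l"
    have "\<not> ?R j (Suc n) l'" for j
    proof
      assume "?R j (Suc n) l'"
      then have "?R (Suc j) n l" using l' that(2) by auto
      then show False using that(1) by (simp only: B_def mem_Collect_eq)
    qed
    then show "l' \<in> B (Suc n)" by (simp add: B_def)
  qed
  have mono: "b n \<le> b (Suc n)" for n
  proof -
    have "b n = (\<Sum>l\<in>B n. \<Sum>\<sigma>\<in>UNIV. flow M \<alpha> n l \<sigma>)" by (simp add: b_def sum_flow)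
    \<comment> \<open>Where the flow is positive, all successors lie in \<open>B (Suc n)\<close>, so
      the inserted sum is 1.\<close>
    also have "\<dots> = (\<Sum>l\<in>B n. \<Sum>\<sigma>\<in>UNIV. flow M \<alpha> n l \<sigma> * (\<Sum>l'\<in>B (Suc n). pmf (trans M l \<sigma>) l'))"
    proof (intro sum.cong refl)
      fix l \<sigma> assume "l \<in> B n"
      then show "flow M \<alpha> n l \<sigma> = flow M \<alpha> n l \<sigma> * (\<Sum>l'\<in>B (Suc n). pmf (trans M l \<sigma>) l')"
        using closed[of l n \<sigma>] flow_nonneg[of M \<alpha> n l \<sigma>]
        by (cases "flow M \<alpha> n l \<sigma> = 0") (auto simp: sum_pmf_eq_1 Post_def)
    qed
    also have "\<dots> \<le> (\<Sum>l\<in>UNIV. \<Sum>\<sigma>\<in>UNIV. flow M \<alpha> n l \<sigma> * (\<Sum>l'\<in>B (Suc n). pmf (trans M l \<sigma>) l'))"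
      by (rule sum_mono2) (auto intro!: sum_nonneg mult_nonneg_nonneg flow_nonneg)
    also have "\<dots> = b (Suc n)"
      unfolding b_def outcome_Suc sum_distrib_left
      by (subst (2) sum.swap) (intro sum.cong refl sum.swap)
    finally show ?thesis .
  qed
  have "b n \<le> 1 - outcome M \<alpha> m (t m)" if m: "m \<ge> max n n0" for m
  proof -
    have "t m \<notin> B m"
    proof
      assume "t m \<in> B m"
      then have "\<not> ?R 0 m (t m)" unfolding B_def by blast
      then show False using m by simp
    qed
    then have "outcome M \<alpha> m (t m) + b m = sum (outcome M \<alpha> m) (insert (t m) (B m))"
      by (simp add: b_def)
    also have "\<dots> \<le> 1" by (rule outcome_sum_le_1)
    finally have "b m \<le> 1 - outcome M \<alpha> m (t m)" by simp
    moreover have "b n \<le> b m" using m by (intro lift_Suc_mono_le[of b, OF mono]) simp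
    ultimately show ?thesis by simp
  qed
  moreover have "(\<lambda>m. 1 - outcome M \<alpha> m (t m)) \<longlonglongrightarrow> 0"
    using tendsto_diff[OF tendsto_const[of 1] lim] by simp
  ultimately have "b n \<le> 0" by (intro LIMSEQ_le_const) blast+
  moreover assume "\<not> ?thesis"
  then have "outcome M \<alpha> n l \<le> b n"
    unfolding b_def by (intro member_le_sum) (auto simp: B_def outcome_nonneg)
  ultimately show False using l by simp
qed

text \<open>On the track, from \<open>n0\<close> on, choose the action leading surely to the next
  \<open>t\<close>; elsewhere choose an action with positive flow that may decrease the distance to
  the track. Positive flow keeps every visited state at positive mass, so the choice never gets
  stuck.\<close>

lemma pure_selector:
  fixes M :: "('l::finite, 'a::finite) mdp"
  assumes lim: "(\<lambda>n. outcome M \<alpha> n (t n)) \<longlonglongrightarrow> 1"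
  obtains n0 \<gamma> where
    "\<And>n m. n \<ge> n0 \<Longrightarrow> post_seq M (\<lambda>i. \<gamma> (n + i)) {t n} m = {t (n + m)}"
    "\<And>n l. l \<in> post_seq M \<gamma> (init_cell M) n \<Longrightarrow>
       \<exists>m. n0 \<le> n + m \<and> t (n + m) \<in> post_seq M (\<lambda>i. \<gamma> (n + i)) {l} m"
proof -
  obtain n0 where n0: "\<And>n. n \<ge> n0 \<Longrightarrow>
      \<exists>\<sigma>. flow M \<alpha> n (t n) \<sigma> > 0 \<and> Post M \<sigma> (t n) = {t (Suc n)}"
    using dirac_action[OF lim] by blast
  let ?P = "\<lambda>n l. n0 \<le> n \<and> l = t n"
  let ?R = "flow_reaches M \<alpha> ?P"
  \<comment> \<open>The least distance to the track; its value is meaningful where some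
    \<open>j\<close> exists, in particular at every state with positive mass.\<close>
  define rk where "rk n l = (LEAST j. ?R j n l)" for n l
  have "\<exists>\<sigma>. outcome M \<alpha> n l > 0 \<longrightarrow> flow M \<alpha> n l \<sigma> > 0 \<and>
      (if ?P n l then Post M \<sigma> l = {t (Suc n)} else \<exists>l'\<in>Post M \<sigma> l. rk (Suc n) l' < rk n l)" for n l
  proof (cases "?P n l")
    case False
    show ?thesis
    proof (cases "outcome M \<alpha> n l > 0")
      case True
      have R: "?R (rk n l) n l"
        unfolding rk_def by (rule LeastI_ex[OF flow_reaches_track[OF lim True]])
      \<comment> \<open>Distance 0 would mean being on the track already.\<close>
      with False obtain j where j: "rk n l = Suc j" by (cases "rk n l") auto
      with R obtain \<sigma> l' where "flow M \<alpha> n l \<sigma> > 0" "l' \<in> Post M \<sigma> l" "?R j (Suc n) l'" by auto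
      moreover from this(3) have "rk (Suc n) l' \<le> j" unfolding rk_def by (rule Least_le)
      then have "rk (Suc n) l' < rk n l" using j by simp
      ultimately show ?thesis unfolding if_not_P[OF False] by blast
    qed simp
  qed (use n0 in auto)
  then obtain \<gamma> where \<gamma>: "\<And>n l. outcome M \<alpha> n l > 0 \<Longrightarrow> flow M \<alpha> n l (\<gamma> n l) > 0 \<and>
      (if ?P n l then Post M (\<gamma> n l) l = {t (Suc n)} else \<exists>l'\<in>Post M (\<gamma> n l) l. rk (Suc n) l' < rk n l)"
    by metis
  have step: "outcome M \<alpha> (Suc n) l' > 0" if "outcome M \<alpha> n l > 0" "l' \<in> Post M (\<gamma> n l) l" for n l l'
  proof -
    have "0 < flow M \<alpha> n l (\<gamma> n l) * pmf (trans M l (\<gamma> n l)) l'"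
      using \<gamma>[OF that(1)] that(2) by (simp add: Post_def pmf_positive)
    also have "\<dots> \<le> outcome M \<alpha> (Suc n) l'" by (rule outcome_Suc_ge)
    finally show ?thesis .
  qed
  have supp: "outcome M \<alpha> n l > 0" if "l \<in> post_seq M \<gamma> (init_cell M) n" for n l
    using that
  proof (induction n arbitrary: l)
    case 0
    then show ?case by (simp add: outcome_0 init_cell_def pmf_positive)
  qed (auto simp: cell_trans_def intro: step)
  show ?thesis
  proof
    fix n m assume n: "n \<ge> n0"
    show "post_seq M (\<lambda>i. \<gamma> (n + i)) {t n} m = {t (n + m)}"
    proof (induction m)
      case (Suc m)
      obtain \<sigma> where "flow M \<alpha> (n + m) (t (n + m)) \<sigma> > 0" using n0[of "n + m"] n by auto
      then have "outcome M \<alpha> (n + m) (t (n + m)) > 0"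
        by (rule order.strict_trans2[OF _ flow_le_outcome])
      from \<gamma>[OF this] n have "Post M (\<gamma> (n + m) (t (n + m))) (t (n + m)) = {t (Suc (n + m))}" by simp
      with Suc show ?case by (simp add: cell_trans_def)
    qed simp
  next
    have "\<exists>m. n0 \<le> n + m \<and> t (n + m) \<in> post_seq M (\<lambda>i. \<gamma> (n + i)) {l} m"
      if "outcome M \<alpha> n l > 0" for n l
      using that
    \<comment> \<open>Time advances along the induction while the rank falls.\<close>
    proof (induction "rk n l" arbitrary: n l rule: less_induct)
      case less
      show ?case
      proof (cases "?P n l")
        case True
        then show ?thesis by (intro exI[of _ 0]) simp
      next
        case False
        then obtain l' where l': "l' \<in> Post M (\<gamma> n l) l" "rk (Suc n) l' < rk n l"
          using \<gamma>[OF less.prems] by auto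
        from less.hyps[OF l'(2) step[OF less.prems l'(1)]] obtain m where
          m: "n0 \<le> Suc n + m" "t (Suc n + m) \<in> post_seq M (\<lambda>i. \<gamma> (Suc n + i)) {l'} m" by blast
        have "{l'} \<subseteq> cell_trans M {l} (\<gamma> n)" using l'(1) by (simp add: cell_trans_def)
        from post_seq_mono[OF this] m(2)
        have "t (n + Suc m) \<in> post_seq M (\<lambda>i. \<gamma> (n + i)) {l} (Suc m)"
          unfolding post_seq_Suc_left by auto
        then show ?thesis using m(1) by (intro exI[of _ "Suc m"]) simp
      qed
    qed
    then show "\<exists>m. n0 \<le> n + m \<and> t (n + m) \<in> post_seq M (\<lambda>i. \<gamma> (n + i)) {l} m"
      if "l \<in> post_seq M \<gamma> (init_cell M) n" for n l
      using supp[OF that] by blast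
  qed
qed

text \<open>The pairs of cell and tracked state take finitely many values, so one recurs infinitely
  often. Two occurrences far enough apart let every state of the cell meet the track in between and
  then follow it to the tracked state.\<close>

lemma synchronizing_imp_cycle:
  fixes M :: "('l::finite, 'a::finite) mdp"
  assumes "strongly_synchronizing M \<alpha>"
  shows "\<exists>C x. accessible_cycle M C \<and> synchronizing_base M C x"
proof -
  obtain t where t: "\<And>n. max_norm (outcome M \<alpha> n) = outcome M \<alpha> n (t n)"
    using max_norm_attained[of "outcome M \<alpha> _"] by metis
  have "(\<lambda>n. outcome M \<alpha> n (t n)) \<longlonglongrightarrow> 1"
    using assms unfolding strongly_synchronizing_iff_tendsto t .
  then obtain n0 \<gamma> where
    track: "\<And>n m. n \<ge> n0 \<Longrightarrow> post_seq M (\<lambda>i. \<gamma> (n + i)) {t n} m = {t (n + m)}" and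
    hit: "\<And>n l. l \<in> post_seq M \<gamma> (init_cell M) n \<Longrightarrow>
       \<exists>m. n0 \<le> n + m \<and> t (n + m) \<in> post_seq M (\<lambda>i. \<gamma> (n + i)) {l} m"
    by (rule pure_selector) blast
  define s where "s n = post_seq M \<gamma> (init_cell M) n" for n
  have s_add: "s (n + i) = post_seq M (\<lambda>i. \<gamma> (n + i)) (s n) i" for n i
    unfolding s_def by (rule post_seq_add)
  have "finite ((\<lambda>n. (s n, t n)) ` {n0..})" by (rule finite_subset[OF subset_UNIV]) simp
  moreover have "infinite {n0..}" by (rule infinite_Ici)
  ultimately obtain n1 where n1: "n1 \<ge> n0" "infinite {n \<in> {n0..}. (s n, t n) = (s n1, t n1)}"
    using pigeonhole_infinite[of "{n0..}" "\<lambda>n. (s n, t n)"] by auto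
  let ?\<gamma> = "\<lambda>i. \<gamma> (n1 + i)"
  obtain m where m: "\<And>l. l \<in> s n1 \<Longrightarrow> t (n1 + m l) \<in> post_seq M ?\<gamma> {l} (m l)"
    using hit[of _ n1] unfolding s_def by metis
  \<comment> \<open>Infinitely many recurrences allow one beyond all hitting times
    \<open>m l\<close>; their maximum exists as there are finitely many states.\<close>
  obtain n2 where "n2 \<in> {n \<in> {n0..}. (s n, t n) = (s n1, t n1)}" "n2 > n1 + Max (range m)"
    using n1(2) by (metis (no_types, lifting) finite_nat_set_iff_bounded_le not_le)
  then have n2: "n2 > n1 + Max (range m)" "s n2 = s n1" "t n2 = t n1" by auto
  define d where "d = n2 - n1"
  have d: "d > 0" "n1 + d = n2" using n2(1) by (auto simp: d_def)
  \<comment> \<open>The cycle runs from \<open>n1\<close> to \<open>n2\<close>: \<open>d + 1\<close>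
    cells and \<open>d\<close> letters, closing because \<open>s n2 = s n1\<close>.\<close>
  define C where "C = (map (\<lambda>i. s (n1 + i)) [0..<Suc d], map ?\<gamma> [0..<d])"
  have len: "length (snd C) = d" by (simp add: C_def)
  have base: "fst C ! 0 = s n1" by (simp add: C_def nth_map[of 0] del: upt_Suc)
  have post: "post_seq M ((!) (snd C)) T i = post_seq M ?\<gamma> T i" if "i \<le> d" for T i
    using that by (intro post_seq_cong) (simp add: C_def)
  have nonempty: "s n \<noteq> {}" for n
    unfolding s_def by (rule post_seq_nonempty) (simp add: init_cell_def set_pmf_not_empty)
  \<comment> \<open>After meeting the track at time \<open>n1 + m l\<close>, the path stays on it
    for the remaining \<open>d - m l\<close> steps and ends in \<open>t n2 = t n1\<close>.\<close>
  have absorb: "t n1 \<in> post_seq M ?\<gamma> {l} d" if l: "l \<in> s n1" for l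
  proof -
    have "m l \<le> Max (range m)" by simp
    then have ml: "d = m l + (d - m l)" using n2(1) unfolding d_def by linarith
    have "{t (n1 + m l + (d - m l))} = post_seq M (\<lambda>i. \<gamma> (n1 + m l + i)) {t (n1 + m l)} (d - m l)"
      using n1(1) by (intro track[symmetric]) simp
    also have "\<dots> \<subseteq> post_seq M (\<lambda>i. \<gamma> (n1 + m l + i)) (post_seq M ?\<gamma> {l} (m l)) (d - m l)"
      using m[OF l] by (intro post_seq_mono) simp
    also have "\<dots> = post_seq M ?\<gamma> {l} d"
      by (subst (2) ml) (simp only: post_seq_add add.assoc)
    finally show ?thesis using ml d(2) n2(3) by (simp add: add.assoc)
  qed
  from nonempty have "is_cycle M C"
    unfolding is_cycle_def C_def using d n2(2)
    by (auto simp: cells_def nth_map s_def simp del: upt_Suc)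
  moreover have "reachable_cell M (fst C ! 0)"
    unfolding base reachable_cell_iff s_def by blast
  ultimately have "accessible_cycle M C" by (simp add: accessible_cycle_def)
  moreover have "synchronizing_base M C (t n1)"
    unfolding synchronizing_base_def
  proof (intro conjI allI impI)
    obtain l where l: "l \<in> s n1" using nonempty by blast
    \<comment> \<open>One round maps the cell onto itself, so the state absorbing its members
      belongs to it.\<close>
    have "t n1 \<in> post_seq M ?\<gamma> (s n1) d"
      using absorb[OF l] post_seq_mono[of "{l}" "s n1" M ?\<gamma> d] l by blast
    then have "t n1 \<in> s n1" using s_add[of n1 d] d(2) n2(2) by simp
    moreover have "post_seq M ((!) (snd C)) {t n1} d = {t n1}"
      using n1(1) n2(3) d(2) by (simp add: post track)
    ultimately show "recurrent_base M C {t n1}" by (simp add: recurrent_base_def base len)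
  next
    show "card (post_seq M ((!) (snd C)) {t n1} i) = 1" if "i \<le> length (snd C)" for i
      using that n1(1) by (simp add: post len track)
  next
    show "t n1 \<in> T" if T: "recurrent_base M C T" for T
    proof -
      \<comment> \<open>Any member of \<open>T\<close> can end a round in \<open>t n1\<close>, and
        \<open>T\<close> is its own image after a round.\<close>
      obtain l where l: "l \<in> T" "l \<in> s n1"
        using T unfolding recurrent_base_def base by blast
      then have "t n1 \<in> post_seq M ?\<gamma> T d"
        using absorb[OF l(2)] post_seq_mono[of "{l}" T M ?\<gamma> d] by blast
      then show ?thesis using T by (simp add: recurrent_base_def post len)
    qed
  qed
  ultimately show ?thesis by blast
qed

theorem theorem1:
  fixes M :: "('l::finite, 'a::finite) mdp"
  shows "(\<exists>\<alpha> :: ('l, 'a) strategy. strongly_synchronizing M \<alpha>) \<longleftrightarrow>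
         (\<exists>C. accessible_cycle M C \<and> card (\<Delta> M C) = 1 \<and>
              (\<forall>G \<in> \<Delta> M C. \<forall>i < length G. card (G ! i) = 1))"
proof -
  have "card (\<Delta> M C) = 1 \<and> (\<forall>G \<in> \<Delta> M C. \<forall>i < length G. card (G ! i) = 1) \<longleftrightarrow>
      (\<exists>x. synchronizing_base M C x)" if "accessible_cycle M C" for C
    using that by (intro synchronizing_cycle_iff) (simp add: accessible_cycle_def)
  then show ?thesis
    using synchronizing_imp_cycle[of M] cycle_imp_synchronizing[of M] by metis
qed

end
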